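(* Let $H_1, H_2$ be non-empty regular graphs with $H_1 \neq H_2$ and $m_2(H_1) \geq m_2(H_2) > 1$, such that $H_2$ is strictly $2$-balanced, and such that $H_1$ is strictly balanced with respect to $d_2(\cdot,H_2)$ if $m_2(H_1) > m_2(H_2)$ and $H_1$ is strictly $2$-balanced if $m_2(H_1) = m_2(H_2)$. Suppose moreover that none of the following holds: (i) one of $H_1,H_2$ is a complete graph and the other is a cycle; (ii) $H_2$ is a cycle and $|V(H_1)| \geq |V(H_2)|$; (iii) $(H_1,H_2) = (K_3, K_{3,3})$. Then there exists a constant $\varepsilon = \varepsilon(H_1,H_2) > 0$ such that $\hat{\mathcal{A}}(H_1,H_2,\varepsilon)$ is finite and every graph in $\hat{\mathcal{A}}(H_1,H_2,\varepsilon)$ has a valid edge-colouring for $H_1$ and $H_2$.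
   Context: For a graph $H$ write $v_H=|V(H)|$, $e_H=|E(H)|$. Define $d_2(H) = (e_H-1)/(v_H-2)$ if $H$ is non-empty and $v_H \geq 3$; $d_2(K_2)=1/2$; $d_2(H)=0$ otherwise. Let $m_2(H)=\max\{d_2(J) : J \subseteq H\}$. $H$ is strictly $2$-balanced if $d_2(J) < m_2(H)$ for every proper subgraph $J \subsetneq H$. For graphs $H_1,H_2$ define $d_2(H_1,H_2) = e_{H_1}/(v_{H_1} - 2 + 1/m_2(H_2))$ if $H_2$ is non-empty and $v_{H_1} \geq 2$, and $0$ otherwise; $m_2(H_1,H_2) = \max\{d_2(J,H_2) : J \subseteq H_1\}$. $H_1$ is strictly balanced with respect to $d_2(\cdot,H_2)$ if $d_2(J,H_2) < m_2(H_1,H_2)$ for every proper subgraph $J \subsetneq H_1$. For a graph $A$, $d(A)=e_A/v_A$ if $v_A\ge1$ and $0$ otherwise; $m(A)=\max\{d(J): J\subseteq A\}$. A red/blue colouring of the edges of $G$ is a valid edge-colouring for $H_1$ and $H_2$ if it contains no red copy of $H_1$ and no blue copy of $H_2$. For a graph $G$, $\mathcal{R}_G$ is the set of subgraphs of $G$ isomorphic to $H_1$ and $\mathcal{L}_G$ the set of subgraphs isomorphic to $H_2$; $\mathcal{L}^*_G = \{L \in \mathcal{L}_G : \forall e \in E(L)\ \exists R \in \mathcal{R}_G,\ E(L)\cap E(R)=\{e\}\}$. $\mathcal{C}(H_1,H_2)$ is the class of graphs $G$ such that every edge $e$ of $G$ satisfies $E(L)\cap E(R)=\{e\}$ for some $L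 \in \mathcal{L}_G$, $R\in\mathcal{R}_G$; $\mathcal{C}^*(H_1,H_2)$ is the class of graphs $G$ in which every edge lies in some $L \in \mathcal{L}^*_G$. For $m_2(H_1)\ge m_2(H_2)>1$ and $\varepsilon>0$, $\hat{\mathcal{A}}(H_1,H_2,\varepsilon)$ is the class of $2$-connected graphs $A$ with $m(A)\le m_2(H_1,H_2)+\varepsilon$ such that $A\in\mathcal{C}^*(H_1,H_2)$ if $m_2(H_1)>m_2(H_2)$, and $A\in\mathcal{C}(H_1,H_2)$ if $m_2(H_1)=m_2(H_2)$. *)

theory Defs
  imports Complex_Main
begin

text \<open>A (finite, simple) graph is a pair (vertex set, edge set); edges are 2-element
  subsets of the vertex set.\<close>

type_synonym 'a graph = "'a set \<times> 'a set set"

definition verts :: "'a graph \<Rightarrow> 'a set" where "verts G = fst G"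
definition edges :: "'a graph \<Rightarrow> 'a set set" where "edges G = snd G"

definition wf_graph :: "'a graph \<Rightarrow> bool" where
  "wf_graph G \<longleftrightarrow> finite (verts G) \<and>
     edges G \<subseteq> {{u, v} | u v. u \<in> verts G \<and> v \<in> verts G \<and> u \<noteq> v}"

definition vnum :: "'a graph \<Rightarrow> nat" where "vnum G = card (verts G)"
definition enum :: "'a graph \<Rightarrow> nat" where "enum G = card (edges G)"

definition subgraph :: "'a graph \<Rightarrow> 'a graph \<Rightarrow> bool" where
  "subgraph J G \<longleftrightarrow> wf_graph J \<and> verts J \<subseteq> verts G \<and> edges J \<subseteq> edges G"

definition isomorphic :: "'a graph \<Rightarrow> 'b graph \<Rightarrow> bool" where
  "isomorphic G H \<longleftrightarrow> (\<exists>f. bij_betw f (verts G) (verts H) \<and>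
     (\<forall>u\<in>verts G. \<forall>v\<in>verts G. {u, v} \<in> edges G \<longleftrightarrow> {f u, f v} \<in> edges H))"

text \<open>non-empty = has at least one edge\<close>
definition nonempty_graph :: "'a graph \<Rightarrow> bool" where
  "nonempty_graph G \<longleftrightarrow> edges G \<noteq> {}"

definition degree :: "'a graph \<Rightarrow> 'a \<Rightarrow> nat" where
  "degree G v = card {e \<in> edges G. v \<in> e}"

definition regular :: "'a graph \<Rightarrow> bool" where
  "regular G \<longleftrightarrow> (\<exists>k. \<forall>v\<in>verts G. degree G v = k)"

definition d2 :: "'a graph \<Rightarrow> real" where
  "d2 H = (if nonempty_graph H \<and> vnum H \<ge> 3
            then (real (enum H) - 1) / (real (vnum H) - 2)
            else if vnum H = 2 \<and> enum H = 1 then 1/2 else 0)"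

definition m2 :: "'a graph \<Rightarrow> real" where
  "m2 H = Max (d2 ` {J. subgraph J H})"

definition strictly_2_balanced :: "'a graph \<Rightarrow> bool" where
  "strictly_2_balanced H \<longleftrightarrow> (\<forall>J. subgraph J H \<and> J \<noteq> H \<longrightarrow> d2 J < m2 H)"

definition d2_pair :: "'a graph \<Rightarrow> 'b graph \<Rightarrow> real" where
  "d2_pair H1 H2 = (if nonempty_graph H2 \<and> vnum H1 \<ge> 2
       then real (enum H1) / (real (vnum H1) - 2 + 1 / m2 H2) else 0)"

definition m2_pair :: "'a graph \<Rightarrow> 'b graph \<Rightarrow> real" where
  "m2_pair H1 H2 = Max ((\<lambda>J. d2_pair J H2) ` {J. subgraph J H1})"

definition strictly_balanced_pair :: "'a graph \<Rightarrow> 'b graph \<Rightarrow> bool" where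
  "strictly_balanced_pair H1 H2 \<longleftrightarrow>
     (\<forall>J. subgraph J H1 \<and> J \<noteq> H1 \<longrightarrow> d2_pair J H2 < m2_pair H1 H2)"

definition dens :: "'a graph \<Rightarrow> real" where
  "dens A = (if vnum A \<ge> 1 then real (enum A) / real (vnum A) else 0)"

definition m_dens :: "'a graph \<Rightarrow> real" where
  "m_dens A = Max (dens ` {J. subgraph J A})"

text \<open>Standard graphs on natural-number vertices.\<close>
definition complete_graph :: "'a graph \<Rightarrow> bool" where
  "complete_graph G \<longleftrightarrow> edges G = {{u, v} | u v. u \<in> verts G \<and> v \<in> verts G \<and> u \<noteq> v}"

definition K :: "nat \<Rightarrow> nat graph" where
  "K n = ({0..<n}, {{u, v} | u v. u < n \<and> v < n \<and> u \<noteq> v})"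

definition cycle_graph :: "nat \<Rightarrow> nat graph" where
  "cycle_graph n = ({0..<n}, {{i, (i + 1) mod n} | i. i < n})"

definition is_cycle :: "'a graph \<Rightarrow> bool" where
  "is_cycle G \<longleftrightarrow> (\<exists>n\<ge>3. isomorphic G (cycle_graph n))"

definition K33 :: "nat graph" where
  "K33 = ({0..<6}, {{u, v} | u v. u < 3 \<and> 3 \<le> v \<and> v < 6})"

text \<open>Connectivity\<close>
definition connected_graph :: "'a graph \<Rightarrow> bool" where
  "connected_graph G \<longleftrightarrow> verts G \<noteq> {} \<and>
     (\<forall>u\<in>verts G. \<forall>v\<in>verts G. (u, v) \<in> {(x, y). {x, y} \<in> edges G}\<^sup>*)"

definition delete_vertex :: "'a graph \<Rightarrow> 'a \<Rightarrow> 'a graph" where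
  "delete_vertex G x = (verts G - {x}, {e \<in> edges G. x \<notin> e})"

definition two_connected :: "'a graph \<Rightarrow> bool" where
  "two_connected G \<longleftrightarrow> vnum G \<ge> 3 \<and> connected_graph G \<and>
     (\<forall>x\<in>verts G. connected_graph (delete_vertex G x))"

text \<open>Copies of H inside G: subgraphs of G isomorphic to H.\<close>
definition copies :: "'b graph \<Rightarrow> 'a graph \<Rightarrow> 'a graph set" where
  "copies H G = {J. subgraph J G \<and> isomorphic J H}"

definition Lstar :: "'b graph \<Rightarrow> 'c graph \<Rightarrow> 'a graph \<Rightarrow> 'a graph set" where
  "Lstar H1 H2 G = {L \<in> copies H2 G. \<forall>e\<in>edges L. \<exists>R\<in>copies H1 G. edges L \<inter> edges R = {e}}"

definition classC :: "'b graph \<Rightarrow> 'c graph \<Rightarrow> 'a graph \<Rightarrow> bool" where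
  "classC H1 H2 G \<longleftrightarrow> (\<forall>e\<in>edges G. \<exists>L\<in>copies H2 G. \<exists>R\<in>copies H1 G. edges L \<inter> edges R = {e})"

definition classCstar :: "'b graph \<Rightarrow> 'c graph \<Rightarrow> 'a graph \<Rightarrow> bool" where
  "classCstar H1 H2 G \<longleftrightarrow> (\<forall>e\<in>edges G. \<exists>L\<in>Lstar H1 H2 G. e \<in> edges L)"

text \<open>A valid colouring: the set of red edges; all other edges of G are blue.\<close>
definition valid_colouring :: "'b graph \<Rightarrow> 'c graph \<Rightarrow> 'a graph \<Rightarrow> 'a set set \<Rightarrow> bool" where
  "valid_colouring H1 H2 G red \<longleftrightarrow> red \<subseteq> edges G \<and>
     (\<forall>R\<in>copies H1 G. \<not> edges R \<subseteq> red) \<and>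
     (\<forall>L\<in>copies H2 G. \<not> edges L \<subseteq> edges G - red)"

definition has_valid_colouring :: "'b graph \<Rightarrow> 'c graph \<Rightarrow> 'a graph \<Rightarrow> bool" where
  "has_valid_colouring H1 H2 G \<longleftrightarrow> (\<exists>red. valid_colouring H1 H2 G red)"

text \<open>The class \<open>\<hat>A(H1,H2,\<epsilon>)\<close>, with graphs on vertex type nat (every finite
  graph is isomorphic to such a graph).\<close>
definition Ahat :: "'b graph \<Rightarrow> 'c graph \<Rightarrow> real \<Rightarrow> nat graph set" where
  "Ahat H1 H2 \<epsilon> = {A. wf_graph A \<and> two_connected A \<and> m_dens A \<le> m2_pair H1 H2 + \<epsilon> \<and>
      (if m2 H1 > m2 H2 then classCstar H1 H2 A else classC H1 H2 A)}"

text \<open>A class of graphs is finite if it has finitely many members up to isomorphism.\<close>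
definition finite_up_to_iso :: "'a graph set \<Rightarrow> bool" where
  "finite_up_to_iso S \<longleftrightarrow> (\<exists>F :: 'a graph set. finite F \<and> (\<forall>A\<in>S. \<exists>B\<in>F. isomorphic A B))"

end

theory Submission
  imports Defs
begin

text \<open>The class is empty for small \<open>\<epsilon>\<close>. If \<open>H\<^sub>i\<close> is \<open>k\<^sub>i\<close>-regular, then every vertex of a graph \<open>A\<close> in the
  class lies in copies of \<open>H\<^sub>1\<close> and \<open>H\<^sub>2\<close> sharing a single edge at that vertex, so \<open>A\<close> has minimum
  degree at least \<open>k\<^sub>1 + k\<^sub>2 - 1\<close> and density at least \<open>(k\<^sub>1 + k\<^sub>2 - 1) / 2\<close>. The excluded pairs are what is
  needed for this to exceed \<open>m\<^sub>2(H\<^sub>1, H\<^sub>2)\<close>.\<close>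

section \<open>Neighbourhoods, degrees and isomorphisms\<close>

definition nbrs :: "'a graph \<Rightarrow> 'a \<Rightarrow> 'a set" where
  "nbrs G v = {u. {u, v} \<in> edges G}"

lemma wf_edgeE:
  assumes "wf_graph G" "e \<in> edges G"
  obtains u v where "e = {u, v}" "u \<in> verts G" "v \<in> verts G" "u \<noteq> v"
  using assms unfolding wf_graph_def by blast

lemma wf_edge_verts:
  assumes "wf_graph G" "{u, v} \<in> edges G"
  shows "u \<in> verts G" "v \<in> verts G" "u \<noteq> v"
  using assms by (auto elim!: wf_edgeE simp: doubleton_eq_iff)

lemma wf_finite_verts: "wf_graph G \<Longrightarrow> finite (verts G)"
  by (simp add: wf_graph_def)

lemma wf_edges_Pow: "wf_graph G \<Longrightarrow> edges G \<subseteq> Pow (verts G)"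
  unfolding wf_graph_def by blast

lemma wf_finite_edges: "wf_graph G \<Longrightarrow> finite (edges G)"
  using finite_subset[OF wf_edges_Pow] wf_finite_verts by blast

lemma nbrs_subset: "wf_graph G \<Longrightarrow> nbrs G v \<subseteq> verts G - {v}"
  by (auto simp: nbrs_def dest: wf_edge_verts)

lemma finite_nbrs: "wf_graph G \<Longrightarrow> finite (nbrs G v)"
  using nbrs_subset wf_finite_verts by (metis finite_Diff finite_subset)

lemma nbrs_sym: "u \<in> nbrs G v \<longleftrightarrow> v \<in> nbrs G u"
  by (simp add: nbrs_def insert_commute)

lemma degree_eq_card_nbrs:
  assumes "wf_graph G"
  shows "degree G v = card (nbrs G v)"
proof -
  have "bij_betw (\<lambda>u. {u, v}) (nbrs G v) {e \<in> edges G. v \<in> e}"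
    unfolding bij_betw_def
  proof
    show "inj_on (\<lambda>u. {u, v}) (nbrs G v)"
      by (auto simp: inj_on_def doubleton_eq_iff)
    show "(\<lambda>u. {u, v}) ` nbrs G v = {e \<in> edges G. v \<in> e}"
      using assms by (force simp: nbrs_def insert_commute elim: wf_edgeE)
  qed
  then show ?thesis by (simp add: degree_def bij_betw_same_card)
qed

text \<open>Handshake lemma: count the incident pairs of a vertex and an edge in both
  orders.\<close>

lemma sum_degree:
  assumes "wf_graph G"
  shows "(\<Sum>v\<in>verts G. degree G v) = 2 * enum G"
proof -
  have fin: "finite (verts G)" "finite (edges G)"
    using assms by (simp_all add: wf_finite_verts wf_finite_edges)
  have "(\<Sum>v\<in>verts G. degree G v) = (\<Sum>v\<in>verts G. \<Sum>e\<in>edges G. if v \<in> e then 1 else 0)"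
    using fin by (simp add: degree_def sum.If_cases Int_def)
  also have "\<dots> = (\<Sum>e\<in>edges G. \<Sum>v\<in>verts G. if v \<in> e then 1 else 0)"
    by (rule sum.swap)
  also have "\<dots> = (\<Sum>e\<in>edges G. 2)"
  proof (rule sum.cong)
    fix e assume "e \<in> edges G"
    then obtain u v where e: "e = {u, v}" "u \<in> verts G" "v \<in> verts G" "u \<noteq> v"
      using assms by (blast elim: wf_edgeE)
    have "(\<Sum>w\<in>verts G. if w \<in> e then 1 else 0) = card (verts G \<inter> e)"
      using fin by (simp add: sum.If_cases Int_def)
    also have "verts G \<inter> e = {u, v}" using e by blast
    finally show "(\<Sum>w\<in>verts G. if w \<in> e then 1 else 0) = (2::nat)" using e by simp
  qed simp
  also have "\<dots> = 2 * enum G" by (simp add: enum_def)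
  finally show ?thesis .
qed

lemma regular_enum:
  assumes "wf_graph G" "\<forall>v\<in>verts G. degree G v = k"
  shows "2 * enum G = k * vnum G"
  using sum_degree[OF assms(1)] assms(2) by (simp add: vnum_def mult.commute)

lemma degree_less_vnum:
  assumes "wf_graph G" "v \<in> verts G"
  shows "degree G v < vnum G"
proof -
  have "card (nbrs G v) \<le> card (verts G - {v})"
    using assms by (intro card_mono nbrs_subset) (simp_all add: wf_finite_verts)
  also have "\<dots> < card (verts G)"
    using assms by (intro card_Diff1_less) (simp_all add: wf_finite_verts)
  finally show ?thesis
    using assms by (simp add: degree_eq_card_nbrs vnum_def)
qed

lemma nonempty_vnum:
  assumes "wf_graph G" "nonempty_graph G"
  shows "vnum G \<ge> 2"
proof -
  obtain e where "e \<in> edges G" using assms(2) by (auto simp: nonempty_graph_def)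
  then obtain u v where "u \<in> verts G" "v \<in> verts G" "u \<noteq> v"
    using assms(1) by (blast elim: wf_edgeE)
  then have "card {u, v} \<le> card (verts G)"
    using assms(1) by (intro card_mono) (auto simp: wf_finite_verts)
  then show ?thesis using \<open>u \<noteq> v\<close> by (simp add: vnum_def)
qed

text \<open>Each neighbourhood lies in the set of the other \<open>k\<close> vertices and has size
  \<open>k\<close>, so it is that set.\<close>

lemma regular_complete:
  assumes "wf_graph G" "\<forall>v\<in>verts G. degree G v = k" "vnum G = k + 1"
  shows "complete_graph G"
proof -
  have "nbrs G v = verts G - {v}" if "v \<in> verts G" for v
    using assms that nbrs_subset[of G v]
    by (intro card_subset_eq) (auto simp: wf_finite_verts degree_eq_card_nbrs vnum_def)
  then have "{u, v} \<in> edges G" if "u \<in> verts G" "v \<in> verts G" "u \<noteq> v" for u v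
    using that by (force simp: nbrs_def)
  then show ?thesis
    using assms(1) unfolding complete_graph_def wf_graph_def by blast
qed

lemma complete_isomorphic:
  assumes "wf_graph G" "wf_graph H" "complete_graph G" "complete_graph H" "vnum G = vnum H"
  shows "isomorphic G H"
proof -
  obtain f where f: "bij_betw f (verts G) (verts H)"
    using assms finite_same_card_bij[of "verts G" "verts H"]
    by (auto simp: wf_finite_verts vnum_def)
  have 1: "{u, v} \<in> edges G \<longleftrightarrow> u \<noteq> v" if "u \<in> verts G" "v \<in> verts G" for u v
    using that wf_edge_verts(3)[OF assms(1)] assms(3) by (auto simp: complete_graph_def)
  have 2: "{u, v} \<in> edges H \<longleftrightarrow> u \<noteq> v" if "u \<in> verts H" "v \<in> verts H" for u v
    using that wf_edge_verts(3)[OF assms(2)] assms(4) by (auto simp: complete_graph_def)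
  have "f u \<in> verts H" if "u \<in> verts G" for u
    using f that by (auto simp: bij_betw_def)
  moreover have "f u = f v \<longleftrightarrow> u = v" if "u \<in> verts G" "v \<in> verts G" for u v
    using f that by (auto simp: bij_betw_def inj_on_def)
  ultimately show ?thesis
    unfolding isomorphic_def using f 1 2 by (intro exI[of _ f]) simp
qed

text \<open>An isomorphism restricts to a bijection between the neighbourhoods of \<open>v\<close>
  and of its image. This carries the degrees of \<open>H1\<close> and \<open>H2\<close> over to
  their copies.\<close>

lemma isomorphic_degree:
  assumes "wf_graph L" "wf_graph H" "isomorphic L H" "\<forall>v\<in>verts H. degree H v = k" "v \<in> verts L"
  shows "degree L v = k"
proof -
  obtain f where f: "bij_betw f (verts L) (verts H)"
    and fe: "\<forall>u\<in>verts L. \<forall>v\<in>verts L. {u, v} \<in> edges L \<longleftrightarrow> {f u, f v} \<in> edges H"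
    using assms(3) by (auto simp: isomorphic_def)
  have fv: "f v \<in> verts H" using f assms(5) by (auto simp: bij_betw_def)
  have "bij_betw f (nbrs L v) (nbrs H (f v))"
    unfolding bij_betw_def
  proof
    show "inj_on f (nbrs L v)"
      using f nbrs_subset[OF assms(1)] by (meson Diff_subset bij_betw_def inj_on_subset subset_trans)
    show "f ` nbrs L v = nbrs H (f v)"
    proof
      show "f ` nbrs L v \<subseteq> nbrs H (f v)"
      proof (rule image_subsetI)
        fix u assume u: "u \<in> nbrs L v"
        then have "u \<in> verts L" using nbrs_subset[OF assms(1)] by blast
        then show "f u \<in> nbrs H (f v)" using u fe assms(5) by (simp add: nbrs_def)
      qed
      show "nbrs H (f v) \<subseteq> f ` nbrs L v"
      proof
        fix w assume w: "w \<in> nbrs H (f v)"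
        then have "w \<in> verts H" using nbrs_subset[OF assms(2)] by blast
        then obtain u where "u \<in> verts L" "w = f u" using f by (auto simp: bij_betw_def)
        then show "w \<in> f ` nbrs L v" using w fe assms(5) by (auto simp: nbrs_def)
      qed
    qed
  qed
  then show ?thesis
    using assms fv by (simp add: degree_eq_card_nbrs bij_betw_same_card)
qed

section \<open>The maxima \<open>m2\<close> and \<open>m2_pair\<close>\<close>

lemma finite_subgraphs:
  assumes "wf_graph G"
  shows "finite {J. subgraph J G}"
proof (rule finite_subset)
  show "{J. subgraph J G} \<subseteq> Pow (verts G) \<times> Pow (edges G)"
    by (auto simp: subgraph_def verts_def edges_def)
qed (use assms in \<open>simp add: wf_finite_verts wf_finite_edges\<close>)

lemma subgraph_refl: "wf_graph G \<Longrightarrow> subgraph G G"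
  by (simp add: subgraph_def)

lemma d2_le_m2: "wf_graph G \<Longrightarrow> subgraph J G \<Longrightarrow> d2 J \<le> m2 G"
  unfolding m2_def by (rule Max_ge) (auto simp: finite_subgraphs)

lemma m2_attained:
  assumes "wf_graph G"
  obtains J where "subgraph J G" "m2 G = d2 J"
proof -
  have "m2 G \<in> d2 ` {J. subgraph J G}"
    unfolding m2_def
  proof (rule Max_in)
    show "d2 ` {J. subgraph J G} \<noteq> {}" using subgraph_refl[OF assms] by blast
  qed (simp add: finite_subgraphs assms)
  then show ?thesis using that by blast
qed

text \<open>A subgraph attaining the maximum cannot be proper, since proper ones lie strictly below
  it.\<close>

lemma strictly_2_balanced_m2:
  assumes "wf_graph G" "strictly_2_balanced G"
  shows "m2 G = d2 G"
  using assms m2_attained[of G] unfolding strictly_2_balanced_def by (metis less_irrefl)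

lemma m2_pair_attained:
  assumes "wf_graph G"
  obtains J where "subgraph J G" "m2_pair G H = d2_pair J H"
proof -
  have "m2_pair G H \<in> (\<lambda>J. d2_pair J H) ` {J. subgraph J G}"
    unfolding m2_pair_def
  proof (rule Max_in)
    show "(\<lambda>J. d2_pair J H) ` {J. subgraph J G} \<noteq> {}" using subgraph_refl[OF assms] by blast
  qed (simp add: finite_subgraphs assms)
  then show ?thesis using that by blast
qed

lemma strictly_balanced_pair_m2_pair:
  assumes "wf_graph G" "strictly_balanced_pair G H"
  shows "m2_pair G H = d2_pair G H"
  using assms m2_pair_attained[of G H] unfolding strictly_balanced_pair_def by (metis less_irrefl)

lemma d2_gt_1D:
  assumes "d2 G > 1"
  shows "nonempty_graph G" "vnum G \<ge> 3" "d2 G = (real (enum G) - 1) / (real (vnum G) - 2)"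
  using assms by (auto simp: d2_def split: if_splits)

lemma subgraph_degree_le:
  assumes "wf_graph G" "subgraph J G"
  shows "degree J v \<le> degree G v"
  unfolding degree_def using assms wf_finite_edges[OF assms(1)]
  by (intro card_mono) (auto simp: subgraph_def)

text \<open>If \<open>k\<close> were at most 1, every subgraph would have at most half as many edges
  as vertices, too few for a 2-density above 1.\<close>

lemma m2_gt_1_degree_ge_2:
  assumes "wf_graph G" "m2 G > 1" "\<forall>v\<in>verts G. degree G v = k"
  shows "k \<ge> 2"
proof (rule ccontr)
  assume "\<not> k \<ge> 2"
  obtain J where J: "subgraph J G" "m2 G = d2 J" using m2_attained assms(1) by blast
  then have d: "d2 J > 1" using assms by simp
  note D = d2_gt_1D[OF d]
  have "2 * enum J = (\<Sum>v\<in>verts J. degree J v)"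
    using J sum_degree by (metis subgraph_def)
  also have "\<dots> \<le> (\<Sum>v\<in>verts J. 1)"
  proof (rule sum_mono)
    fix v assume "v \<in> verts J"
    then have "v \<in> verts G" using J(1) by (auto simp: subgraph_def)
    then show "degree J v \<le> 1"
      using subgraph_degree_le[OF assms(1) J(1), of v] assms(3) \<open>\<not> k \<ge> 2\<close> by fastforce
  qed
  finally have "2 * enum J \<le> vnum J" by (simp add: vnum_def)
  then have "(real (enum J) - 1) / (real (vnum J) - 2) \<le> 1"
    using D(2) by (subst divide_le_eq) auto
  then show False using d D(3) by simp
qed

text \<open>In the symmetric case \<open>K\<^sub>2\<close> also attains the maximum, so only the value of \<open>m2_pair\<close>, not
  strict balancedness, carries over.\<close>
lemma m2_pair_symmetric:
  assumes "wf_graph G" "strictly_2_balanced G" "nonempty_graph H" "m2 G = m2 H" "m2 H > 1"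
  shows "m2_pair G H = d2_pair G H"
proof -
  define m where "m = m2 H"
  have m: "m > 1" "m2 G = m" using assms by (simp_all add: m_def)
  have dG: "d2 G = m" using strictly_2_balanced_m2 assms m by metis
  note D = d2_gt_1D[of G, unfolded dG, OF m(1)]
  \<comment> \<open>\<open>d2 G = m\<close> says that \<open>enum G - 1\<close> is
    \<open>m * (vnum G - 2)\<close>; moving the 1 into the bracket as \<open>1 / m\<close> produces
    the denominator of \<open>d2_pair\<close>.\<close>
  have "real (enum G) = m * (real (vnum G) - 2 + 1 / m)"
    using D m by (simp add: field_simps)
  moreover have "real (vnum G) - 2 + 1 / m > 0" using D m by (simp add: add_nonneg_pos)
  ultimately have G: "d2_pair G H = m"
    using D(2) assms(3) by (simp add: d2_pair_def m_def[symmetric])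
  have le: "d2_pair J H \<le> m" if J: "subgraph J G" for J
  proof (cases "vnum J \<ge> 2")
    case False
    then show ?thesis using m by (simp add: d2_pair_def)
  next
    case True
    have pos: "real (vnum J) - 2 + 1 / m > 0" using True m by (simp add: add_nonneg_pos)
    \<comment> \<open>The target \<open>d2_pair J H \<le> m\<close> with its denominator
      cleared.\<close>
    have "real (enum J) \<le> m * (real (vnum J) - 2) + 1"
    proof (cases "nonempty_graph J")
      case False
      then show ?thesis using True m by (simp add: enum_def nonempty_graph_def)
    next
      case ne: True
      have wJ: "wf_graph J" using J by (simp add: subgraph_def)
      show ?thesis
      proof (cases "vnum J \<ge> 3")
        case True
        then have "(real (enum J) - 1) / (real (vnum J) - 2) \<le> m"
          using d2_le_m2[OF assms(1) J] ne m by (simp add: d2_def)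
        then show ?thesis using True by (simp add: field_simps)
      next
        case False
        \<comment> \<open>On two vertices \<open>d2\<close> takes its special value, so
          \<open>d2_le_m2\<close> gives nothing; instead there is at most one edge, and a single
          edge gives equality in the bound.\<close>
        then have v2: "vnum J = 2" using True by simp
        have "(\<Sum>v\<in>verts J. degree J v) \<le> (\<Sum>v\<in>verts J. 1)"
          using degree_less_vnum[OF wJ] v2 by (intro sum_mono) force
        then have "2 * enum J \<le> 2"
          using sum_degree[OF wJ] v2 by (simp add: vnum_def)
        then show ?thesis using v2 by simp
      qed
    qed
    also have "\<dots> = m * (real (vnum J) - 2 + 1 / m)" using m by (simp add: field_simps)
    finally show ?thesis
      using True assms(3) pos by (simp add: d2_pair_def m_def[symmetric] pos_divide_le_eq)
  qed
  obtain J where J: "subgraph J G" "m2_pair G H = d2_pair J H"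
    using m2_pair_attained assms(1) by blast
  have "d2_pair G H \<le> m2_pair G H"
    unfolding m2_pair_def using finite_subgraphs[OF assms(1)] subgraph_refl[OF assms(1)]
    by (intro Max_ge) blast+
  with le[OF J(1)] J(2) G show ?thesis by simp
qed

section \<open>Cycles and two-regular graphs\<close>

text \<open>Used to recognise a cycle from an injective numbering of its vertices; the isomorphism
  is the inverse of \<open>g\<close>.\<close>

lemma isomorphic_image:
  assumes "inj_on g (verts C)" "wf_graph C"
  shows "isomorphic (g ` verts C, (`) g ` edges C) C"
proof -
  have iff: "{g a, g b} \<in> (`) g ` edges C \<longleftrightarrow> {a, b} \<in> edges C"
    if "a \<in> verts C" "b \<in> verts C" for a b
  proof
    assume "{g a, g b} \<in> (`) g ` edges C"
    then obtain e where e: "e \<in> edges C" "g ` {a, b} = g ` e" by auto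
    have "e \<subseteq> verts C" using e assms(2) wf_edges_Pow by blast
    then have "{a, b} = e"
      using e(2) that assms(1) by (subst (asm) inj_on_image_eq_iff[of g "verts C"]) auto
    then show "{a, b} \<in> edges C" using e by simp
  next
    assume "{a, b} \<in> edges C"
    then have "g ` {a, b} \<in> (`) g ` edges C" by (rule imageI)
    then show "{g a, g b} \<in> (`) g ` edges C" by simp
  qed
  have "bij_betw (the_inv_into (verts C) g) (g ` verts C) (verts C)"
    using assms(1) by (simp add: bij_betw_the_inv_into bij_betw_imageI)
  then show ?thesis
    unfolding isomorphic_def
    by (intro exI[of _ "the_inv_into (verts C) g"])
      (auto simp: verts_def[of "(_, _)"] edges_def[of "(_, _)"] the_inv_into_f_f[OF assms(1)] iff)
qed

lemma wf_cycle_graph: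
  assumes "n \<ge> 3"
  shows "wf_graph (cycle_graph n)"
proof -
  have "i \<noteq> Suc i mod n \<and> Suc i mod n < n" if "i < n" for i
    using that assms by (auto simp: mod_Suc)
  then show ?thesis
    by (fastforce simp: wf_graph_def cycle_graph_def verts_def edges_def)
qed

text \<open>Different \<open>i\<close> give different edges once \<open>n \<ge> 3\<close>; for
  \<open>n = 2\<close> the two edges would coincide.\<close>

lemma card_edges_cycle_graph:
  assumes "n \<ge> 3"
  shows "card (edges (cycle_graph n)) = n"
proof -
  have "edges (cycle_graph n) = (\<lambda>i. {i, (i + 1) mod n}) ` {..<n}"
    by (auto simp: cycle_graph_def edges_def)
  moreover have "inj_on (\<lambda>i. {i, (i + 1) mod n}) {..<n}"
    using assms by (auto simp: inj_on_def doubleton_eq_iff mod_Suc split: if_splits)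
  ultimately show ?thesis by (simp add: card_image)
qed

text \<open>Walk without ever turning back; the first repeated vertex closes a cycle.\<close>
lemma min_degree_2_cycle:
  assumes wf: "wf_graph G" and ne: "verts G \<noteq> {}" and deg: "\<forall>v\<in>verts G. degree G v \<ge> 2"
  obtains J n where "subgraph J G" "n \<ge> 3" "isomorphic J (cycle_graph n)" "vnum J = n" "enum J = n"
proof -
  have step: "\<exists>w. w \<in> nbrs G v \<and> w \<noteq> u" if "v \<in> verts G" for u v
  proof (rule ccontr)
    assume "\<nexists>w. w \<in> nbrs G v \<and> w \<noteq> u"
    then have "card (nbrs G v) \<le> card {u}" by (intro card_mono) auto
    then show False using deg that degree_eq_card_nbrs[OF wf, of v] by fastforce
  qed
  \<comment> \<open>\<open>u\<close> is the predecessor of \<open>v\<close> on the walk; having two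
    neighbours guarantees another way out.\<close>
  define nxt where "nxt u v = (SOME w. w \<in> nbrs G v \<and> w \<noteq> u)" for u v
  have nxt: "nxt u v \<in> nbrs G v" "nxt u v \<noteq> u" if "v \<in> verts G" for u v
    using someI_ex[OF step[OF that, of u]] by (simp_all add: nxt_def)
  obtain a where a: "a \<in> verts G" using ne by blast
  \<comment> \<open>\<open>p i\<close> holds the pair of \<open>x i\<close> and
    \<open>x (Suc i)\<close>. The first vertex has no predecessor, so \<open>a\<close> stands in for
    it, which is harmless as \<open>a\<close> is not its own neighbour.\<close>
  define p where "p = rec_nat (a, nxt a a) (\<lambda>_ (u, v). (v, nxt u v))"
  define x where "x i = fst (p i)" for i
  have p_Suc: "p (Suc i) = (snd (p i), nxt (fst (p i)) (snd (p i)))" for i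
    by (simp add: p_def split_beta)
  have x_Suc: "snd (p i) = x (Suc i)" for i by (simp add: x_def p_Suc)
  have x_SS: "x (Suc (Suc i)) = nxt (x i) (x (Suc i))" for i
    by (metis p_Suc snd_conv x_Suc x_def)
  have nv: "w \<in> verts G" if "w \<in> nbrs G v" for v w using that nbrs_subset[OF wf] by blast
  have xv: "x i \<in> verts G \<and> x (Suc i) \<in> nbrs G (x i)" for i
  proof (induction i)
    case 0
    have "x 0 = a" "x (Suc 0) = nxt a a"
      by (simp_all add: x_def p_def)
    then show ?case using a nxt by simp
  next
    case (Suc i)
    then show ?case using nxt(1) nv x_SS by metis
  qed
  have x2: "x (Suc (Suc i)) \<noteq> x i" for i using nxt(2) xv x_SS by metis
  have x1: "x (Suc i) \<noteq> x i" for i using xv nbrs_subset[OF wf] by blast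
  have "\<exists>j. \<exists>i<j. x i = x j"
  proof (rule ccontr)
    assume "\<nexists>j. \<exists>i<j. x i = x j"
    then have "inj x" by (metis injI linorder_neqE_nat)
    moreover have "finite (range x)"
      using finite_subset[of "range x" "verts G"] xv wf by (auto simp: wf_finite_verts)
    ultimately show False using finite_imageD infinite_UNIV_nat by blast
  qed
  \<comment> \<open>The least index at which an earlier vertex recurs.\<close>
  then obtain j where j: "\<exists>i<j. x i = x j" and jmin: "\<And>k. k < j \<Longrightarrow> \<not> (\<exists>i<k. x i = x k)"
    using exists_least_iff[of "\<lambda>j. \<exists>i<j. x i = x j"] by blast
  obtain i where i: "i < j" "x i = x j" using j by blast
  define n where "n = j - i"
  define g where "g k = x (i + k)" for k
  have gn: "g n = g 0" using i by (simp add: g_def n_def)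
  \<comment> \<open>A closed segment of length 1 would be a loop, and one of length 2 a turn
    back.\<close>
  have "n \<noteq> 0" using i by (simp add: n_def)
  moreover have "n \<noteq> 1" using x1[of i] gn by (auto simp: g_def)
  moreover have "n \<noteq> 2" using x2[of i] gn by (auto simp: g_def)
  ultimately have n3: "n \<ge> 3" by simp
  \<comment> \<open>A coincidence inside the segment would be a repetition before
    \<open>j\<close>.\<close>
  have inj: "inj_on g {0..<n}"
  proof (rule linorder_inj_onI)
    fix k l assume "k < l" "k \<in> {0..<n}" "l \<in> {0..<n}"
    then show "g k \<noteq> g l"
      using jmin[of "i + l"] i by (force simp: g_def n_def)
  qed auto
  define C where "C = cycle_graph n"
  have vC: "verts C = {0..<n}" by (simp add: C_def cycle_graph_def verts_def)
  have wC: "wf_graph C" using wf_cycle_graph n3 by (simp add: C_def)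
  define J where "J = (g ` verts C, (`) g ` edges C)"
  have vJ: "verts J = g ` verts C" and eJ: "edges J = (`) g ` edges C"
    by (simp_all add: J_def verts_def edges_def)
  have ginj: "inj_on g (verts C)" using inj vC by simp
  \<comment> \<open>The index wraps from \<open>n - 1\<close> to 0, which agrees with the walk
    because \<open>g n = g 0\<close>.\<close>
  have gmod: "g (Suc k mod n) = g (Suc k)" if "k < n" for k
    using that gn by (auto simp: mod_Suc)
  have edge: "{g k, g (Suc k)} \<in> edges G" for k
    using xv[of "i + k"] by (simp add: g_def nbrs_def insert_commute)
  have eJG: "edges J \<subseteq> edges G"
    using edge by (auto simp: eJ C_def cycle_graph_def edges_def[of "(_, _)"] gmod)
  have wJ: "wf_graph J"
    unfolding wf_graph_def
  proof
    show "finite (verts J)" by (simp add: vJ vC)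
    show "edges J \<subseteq> {{u, v} |u v. u \<in> verts J \<and> v \<in> verts J \<and> u \<noteq> v}"
    proof
      fix e assume "e \<in> edges J"
      then obtain f where f: "f \<in> edges C" "e = g ` f" by (auto simp: eJ)
      obtain a b where "f = {a, b}" "a \<in> verts C" "b \<in> verts C" "a \<noteq> b"
        using f(1) wC by (blast elim: wf_edgeE)
      then show "e \<in> {{u, v} |u v. u \<in> verts J \<and> v \<in> verts J \<and> u \<noteq> v}"
        using f(2) ginj by (auto simp: vJ inj_on_def)
    qed
  qed
  show ?thesis
  proof (rule that)
    show "subgraph J G"
      using wJ eJG xv by (auto simp: subgraph_def vJ g_def)
    show "isomorphic J (cycle_graph n)"
      using isomorphic_image[OF ginj wC] by (simp add: J_def C_def)
    show "vnum J = n" using ginj by (simp add: vnum_def vJ card_image vC)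
    have "inj_on ((`) g) (edges C)"
      using inj_on_image_Pow[OF ginj] wf_edges_Pow[OF wC] inj_on_subset by blast
    then show "enum J = n"
      using card_edges_cycle_graph[OF n3] by (simp add: enum_def eJ card_image C_def)
  qed (fact n3)
qed

text \<open>The shorter a cycle, the larger its 2-density.\<close>
lemma two_regular_strictly_2_balanced_is_cycle:
  assumes wf: "wf_graph G" and bal: "strictly_2_balanced G" and m: "m2 G > 1"
    and reg: "\<forall>v\<in>verts G. degree G v = 2"
  shows "is_cycle G"
proof -
  have dG: "m2 G = d2 G" using strictly_2_balanced_m2 wf bal by blast
  note D = d2_gt_1D[OF m[unfolded dG]]
  have eG: "enum G = vnum G" using regular_enum[OF wf reg] by simp
  have "verts G \<noteq> {}" using D(2) by (auto simp: vnum_def)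
  then obtain J n where J: "subgraph J G" "n \<ge> 3" "isomorphic J (cycle_graph n)" "vnum J = n" "enum J = n"
    using min_degree_2_cycle[OF wf] reg by (metis order_refl)
  have "n \<le> vnum G"
    using J wf by (auto simp: subgraph_def vnum_def intro!: card_mono wf_finite_verts)
  then have "(real (vnum G) - 1) / (real (vnum G) - 2) \<le> (real n - 1) / (real n - 2)"
    using J(2) by (simp add: field_simps)
  moreover have "nonempty_graph J" using J by (auto simp: nonempty_graph_def enum_def)
  ultimately have "m2 G \<le> d2 J" using J D(3) dG eG by (simp add: d2_def)
  \<comment> \<open>A proper subgraph would lie strictly below \<open>m2 G\<close>, so the cycle
    found is all of \<open>G\<close>.\<close>
  then have "J = G" using bal J(1) unfolding strictly_2_balanced_def by (metis not_le)
  then show ?thesis using J by (auto simp: is_cycle_def)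
qed

section \<open>Triangles, \<open>K33\<close> and \<open>K 3\<close>\<close>

text \<open>A cubic graph on six vertices also has 2-density (9 - 1) / (6 - 2) = 2, so a triangle in
  it rules out strict 2-balance.\<close>

lemma triangle_d2:
  assumes "wf_graph G" "{a, b} \<in> edges G" "{b, c} \<in> edges G" "{a, c} \<in> edges G"
  shows "subgraph ({a, b, c}, {{a, b}, {b, c}, {a, c}}) G"
    and "d2 ({a, b, c}, {{a, b}, {b, c}, {a, c}}) = 2"
proof -
  have d: "a \<noteq> b" "b \<noteq> c" "a \<noteq> c" using assms wf_edge_verts by metis+
  have v: "a \<in> verts G" "b \<in> verts G" "c \<in> verts G" using assms wf_edge_verts by metis+
  show "subgraph ({a, b, c}, {{a, b}, {b, c}, {a, c}}) G"
    using assms d v by (fastforce simp: subgraph_def wf_graph_def verts_def[of "(_, _)"] edges_def[of "(_, _)"])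
  show "d2 ({a, b, c}, {{a, b}, {b, c}, {a, c}}) = 2"
    using d by (simp add: d2_def nonempty_graph_def vnum_def enum_def verts_def edges_def doubleton_eq_iff)
qed

text \<open>The neighbourhood \<open>B\<close> of a vertex is independent, so each of its members
  sends its three edges into the remaining three vertices \<open>A\<close>. All pairs between
  \<open>A\<close> and \<open>B\<close> are then adjacent, which uses up the degrees in
  \<open>A\<close> as well.\<close>

lemma cubic_triangle_free_K33:
  assumes wf: "wf_graph G" and reg: "\<forall>v\<in>verts G. degree G v = 3" and v6: "vnum G = 6"
    and tf: "\<And>a b c. {a, b} \<in> edges G \<Longrightarrow> {b, c} \<in> edges G \<Longrightarrow> {a, c} \<notin> edges G"
  shows "isomorphic G K33"
proof -
  have fin: "finite (verts G)" using wf by (rule wf_finite_verts)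
  have cn: "card (nbrs G v) = 3" if "v \<in> verts G" for v
    using reg that degree_eq_card_nbrs[OF wf] by metis
  have "verts G \<noteq> {}" using v6 by (auto simp: vnum_def)
  then obtain v where v: "v \<in> verts G" by blast
  define B where "B = nbrs G v"
  define A where "A = verts G - B"
  have B: "B \<subseteq> verts G" "card B = 3" using nbrs_subset[OF wf] cn v by (auto simp: B_def)
  have A: "card A = 3" using B v6 fin by (simp add: A_def card_Diff_subset finite_subset vnum_def)
  have NB: "nbrs G b = A" if b: "b \<in> B" for b
  proof (rule card_subset_eq)
    show "finite A" using fin by (simp add: A_def)
    show "nbrs G b \<subseteq> A"
    proof
      fix u assume u: "u \<in> nbrs G b"
      have "u \<notin> B"
        using tf[of u b v] u b by (auto simp: B_def nbrs_def)
      then show "u \<in> A" using u nbrs_subset[OF wf] by (auto simp: A_def)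
    qed
    show "card (nbrs G b) = card A" using cn A B b by auto
  qed
  have NA: "nbrs G a = B" if a: "a \<in> A" for a
  proof (rule card_subset_eq[symmetric])
    show "finite (nbrs G a)" by (rule finite_nbrs[OF wf])
    show "B \<subseteq> nbrs G a" using NB a nbrs_sym by fastforce
    show "card B = card (nbrs G a)" using cn A_def B a by auto
  qed
  have "finite A" "finite B" using fin B finite_subset by (auto simp: A_def)
  then obtain f h where f: "bij_betw f A {0..<3::nat}" and h: "bij_betw h B {3..<6::nat}"
    using A B finite_same_card_bij[of A "{0..<3::nat}"] finite_same_card_bij[of B "{3..<6::nat}"] by auto
  define q where "q u = (if u \<in> A then f u else h u)" for u
  have qA: "bij_betw q A {0..<3}" using f bij_betw_cong[of A q f] by (simp add: q_def)
  have qB: "bij_betw q B {3..<6}" using h bij_betw_cong[of B q h] by (simp add: q_def A_def)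
  have "bij_betw q (A \<union> B) ({0..<3} \<union> {3..<6})"
    using qA qB by (rule bij_betw_combine) auto
  moreover have "A \<union> B = verts G" using B by (auto simp: A_def)
  moreover have "{0..<3} \<union> {3..<6} = {0..<6::nat}" by auto
  ultimately have bij: "bij_betw q (verts G) (verts K33)" by (simp add: K33_def verts_def)
  have q3: "q u < 3 \<longleftrightarrow> u \<in> A" "q u < 6" if "u \<in> verts G" for u
    using that qA qB by (auto simp: A_def bij_betw_def) (fastforce dest: equalityD1)+
  have eG: "{u, w} \<in> edges G \<longleftrightarrow> (u \<in> A) \<noteq> (w \<in> A)" if "u \<in> verts G" "w \<in> verts G" for u w
    using NA[of w] NB[of w] that by (auto simp: A_def nbrs_def)
  have eK: "{r, s} \<in> edges K33 \<longleftrightarrow> (r < 3) \<noteq> (s < 3)" if "r < 6" "s < 6" for r s :: nat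
  proof -
    have "{r, s} \<in> edges K33 \<longleftrightarrow> (r < 3 \<and> 3 \<le> s \<and> s < 6) \<or> (s < 3 \<and> 3 \<le> r \<and> r < 6)"
      unfolding K33_def edges_def by (auto simp: doubleton_eq_iff)
    then show ?thesis using that by auto
  qed
  show ?thesis
    unfolding isomorphic_def using bij
    by (intro exI[of _ q]) (auto simp: eG eK q3)
qed

text \<open>Makes the triangle both complete and a cycle, so that the exclusion of such pairs
  applies to it.\<close>

lemma K_3_eq_cycle_graph_3: "K 3 = cycle_graph 3"
proof -
  have "{{u, v} |u v. u < 3 \<and> v < 3 \<and> u \<noteq> v} \<subseteq> {{i, (i + 1) mod 3} |i. i < (3::nat)}"
  proof clarify
    fix u v :: nat assume uv: "u < 3" "v < 3" "u \<noteq> v"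
    then have "u = 0 \<or> u = 1 \<or> u = 2" "v = 0 \<or> v = 1 \<or> v = 2" by linarith+
    with uv have "v = (u + 1) mod 3 \<or> u = (v + 1) mod 3" by auto
    then show "\<exists>i. {u, v} = {i, (i + 1) mod 3} \<and> i < 3"
    proof
      assume "v = (u + 1) mod 3"
      then show ?thesis using uv by blast
    next
      assume "u = (v + 1) mod 3"
      then show ?thesis using uv by (intro exI[of _ v]) (simp add: insert_commute)
    qed
  qed
  moreover have "{{i, (i + 1) mod 3} |i. i < (3::nat)} \<subseteq> {{u, v} |u v. u < 3 \<and> v < 3 \<and> u \<noteq> v}"
  proof clarify
    fix i :: nat assume "i < 3"
    then have "i = 0 \<or> i = 1 \<or> i = 2" by linarith
    then have "i \<noteq> (i + 1) mod 3" by auto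
    with \<open>i < 3\<close> show "\<exists>u v. {i, (i + 1) mod 3} = {u, v} \<and> u < 3 \<and> v < 3 \<and> u \<noteq> v"
      by (intro exI[of _ i] exI[of _ "(i + 1) mod 3"]) simp
  qed
  ultimately have "{{u, v} |u v. u < 3 \<and> v < 3 \<and> u \<noteq> v} = {{i, (i + 1) mod 3} |i. i < (3::nat)}"
    by (rule equalityI)
  then show ?thesis by (simp only: K_def cycle_graph_def)
qed

lemma K_wf_complete: "wf_graph (K n)" "complete_graph (K n)" "vnum (K n) = n"
  by (auto simp: K_def wf_graph_def complete_graph_def vnum_def verts_def edges_def)

section \<open>The gap between \<open>m2_pair H1 H2\<close> and
  \<open>(k1 + k2 - 1) / 2\<close>\<close>

text \<open>With \<open>v1\<close>, \<open>v2\<close> the orders of \<open>H1\<close>,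
  \<open>H2\<close>, the number \<open>\<mu>\<close> is \<open>1 / m2 H2\<close> and the left side
  is \<open>d2_pair H1 H2\<close>. Condition \<open>c2\<close> covers the case that
  \<open>H2\<close> is a cycle, \<open>c33\<close> excludes \<open>K 3\<close> with
  \<open>K 4\<close> or \<open>K33\<close>, and \<open>c44\<close> excludes \<open>K 4\<close> with
  itself.\<close>

lemma regular_pair_density_bound:
  fixes k1 k2 v1 v2 :: nat
  assumes k: "k1 \<ge> 2" "k2 \<ge> 2" and v: "v1 \<ge> k1 + 1" "v2 \<ge> k2 + 1" "v2 \<ge> 3"
    and ev: "even (k2 * v2)"
    and c2: "k2 = 2 \<Longrightarrow> v1 \<ge> k1 + 2 \<and> v1 < v2"
    and c33: "\<not> (k1 = 2 \<and> v1 = 3 \<and> k2 = 3 \<and> (v2 = 4 \<or> v2 = 6))"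
    and c44: "\<not> (k1 = 3 \<and> v1 = 4 \<and> k2 = 3 \<and> v2 = 4)"
  defines "\<mu> \<equiv> (real v2 - 2) / (real k2 * real v2 / 2 - 1)"
  shows "(real k1 * real v1 / 2) / (real v1 - 2 + \<mu>) < (real k1 + real k2 - 1) / 2"
proof -
  have "k2 * v2 \<ge> 2 * 3" using k v by (intro mult_mono) auto
  then have "real (k2 * v2) \<ge> real 6" by (simp only: of_nat_le_iff)
  then have D: "real k2 * real v2 / 2 - 1 > 0" by simp
  have mu: "\<mu> > 0" unfolding \<mu>_def using D v by simp
  \<comment> \<open>The claim after clearing the positive denominator and collecting the terms in
    \<open>v1\<close>.\<close>
  have "(real k1 + real k2 - 1) * (2 - \<mu>) < (real k2 - 1) * real v1"
  proof -
    \<comment> \<open>For \<open>k2 \<ge> 4\<close> the product \<open>(k1 - 1) * (k2 - 3)\<close>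
      is at least 2, except that it is 1 at \<open>k1 = 2\<close>, \<open>k2 = 4\<close>.\<close>
    consider "k2 = 2" | "k2 = 3" "v1 \<ge> k1 + 2" | "k2 = 3" "v1 = k1 + 1"
      | "k2 \<ge> 4" "(k1 - 1) * (k2 - 3) \<ge> 2" | "k2 = 4" "k1 = 2"
    proof -
      have "(k1 - 1) * (k2 - 3) \<ge> 2" if "k2 \<ge> 4" "\<not> (k2 = 4 \<and> k1 = 2)"
      proof (cases "k2 = 4")
        case True
        then show ?thesis using that k by auto
      next
        case False
        then have "1 * 2 \<le> (k1 - 1) * (k2 - 3)" using that k by (intro mult_mono) auto
        then show ?thesis by simp
      qed
      moreover have "k2 = 2 \<or> k2 = 3 \<or> k2 \<ge> 4" "v1 = k1 + 1 \<or> v1 \<ge> k1 + 2"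
        using k v by linarith+
      ultimately show ?thesis using that by blast
    qed
    then show ?thesis
    proof cases
      \<comment> \<open>Both halves of \<open>c2\<close> enter: \<open>v1 \<ge> k1 + 2\<close>
        leaves a surplus of \<open>v2\<close>, which beats \<open>v1\<close>.\<close>
      case 1
      have "\<mu> = (real v2 - 2) / (real v2 - 1)" using 1 by (simp add: \<mu>_def)
      then have "2 - \<mu> = real v2 / (real v2 - 1)" using v by (simp add: field_simps)
      moreover have "(real k1 + 1) * (real v2 / (real v2 - 1)) < real v1"
      proof -
        have "(real k1 + 2) * real v2 \<le> real v1 * real v2"
          using c2[OF 1] by (intro mult_right_mono) auto
        then have "(real k1 + 1) * real v2 < real v1 * (real v2 - 1)"
          using c2[OF 1] by (simp add: algebra_simps)
        then show ?thesis using v by (simp add: pos_divide_less_eq)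
      qed
      ultimately show ?thesis using 1 by (simp add: add.commute)
    next
      \<comment> \<open>The bound already holds with 2 in place of \<open>2 - \<mu>\<close>;
        positivity of \<open>\<mu>\<close> makes it strict.\<close>
      case 2
      have "(real k1 + 2) * (2 - \<mu>) < (real k1 + 2) * 2"
        using mu by (intro mult_strict_left_mono) auto
      moreover have "real v1 \<ge> real k1 + 2" using 2 by linarith
      ultimately show ?thesis using 2 by (simp add: algebra_simps)
    next
      case 3
      have "even v2" using ev 3 by simp
      have muE: "\<mu> = (2 * real v2 - 4) / (3 * real v2 - 2)"
        using 3 v by (simp add: \<mu>_def field_simps)
      \<comment> \<open>What the claim becomes for \<open>v1 = k1 + 1\<close>. As
        \<open>\<mu>\<close> grows with \<open>v2\<close>, from 2/5 at \<open>v2 = 4\<close> to 1/2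
        at \<open>v2 = 6\<close>, small values are critical: equality occurs at
        \<open>k1 = 2\<close>, \<open>v2 = 6\<close> and at \<open>k1 = 3\<close>,
        \<open>v2 = 4\<close>, and the inequality is reversed at \<open>k1 = 2\<close>,
        \<open>v2 = 4\<close>. These are the excluded pairs.\<close>
      have "2 < (real k1 + 2) * \<mu>"
      proof -
        consider "k1 = 2" "v2 \<ge> 8" | "k1 = 3" "v2 \<ge> 6" | "k1 \<ge> 4"
        proof -
          have "v2 \<noteq> 5" "v2 \<noteq> 7" using \<open>even v2\<close> by auto
          then have "v2 = 4 \<or> v2 = 6 \<or> v2 \<ge> 8" using v 3 by linarith
          moreover have "k1 = 2 \<or> k1 = 3 \<or> k1 \<ge> 4" using k by linarith
          ultimately show ?thesis using that 3 c33 c44 by auto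
        qed
        then show ?thesis
        proof cases
          case 1 then show ?thesis unfolding muE by (simp add: field_simps)
        next
          case 2 then show ?thesis unfolding muE by (simp add: field_simps)
        next
          case k4: 3
          have "\<mu> > 1/3" unfolding muE using v 3 by (simp add: field_simps)
          then have "6 * (1/3) < (real k1 + 2) * \<mu>"
            using k4 by (intro mult_le_less_imp_less) auto
          then show ?thesis by simp
        qed
      qed
      then show ?thesis using 3 by (simp add: algebra_simps)
    next
      case 4
      have "real ((k1 - 1) * (k2 - 3)) \<ge> real 2" using 4(2) by (simp only: of_nat_le_iff)
      then have "(real k1 - 1) * (real k2 - 3) \<ge> 2" using k 4 by (simp add: of_nat_diff)
      \<comment> \<open>The right side minus the left side is
        \<open>(k1 - 1) * (k2 - 3) - 2\<close>.\<close>
      then have "(real k1 + real k2 - 1) * 2 \<le> (real k2 - 1) * (real k1 + 1)"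
        by (simp add: algebra_simps)
      also have "\<dots> \<le> (real k2 - 1) * real v1" using k v by (intro mult_left_mono) auto
      finally have "(real k1 + real k2 - 1) * 2 \<le> (real k2 - 1) * real v1" .
      moreover have "(real k1 + real k2 - 1) * (2 - \<mu>) < (real k1 + real k2 - 1) * 2"
        using mu k by (intro mult_strict_left_mono) auto
      ultimately show ?thesis by linarith
    next
      case 5
      \<comment> \<open>The claim reads \<open>5 * (2 - \<mu>) < 3 * v1\<close>; in the worst case
        \<open>v1 = 3\<close> this is exactly the present bound.\<close>
      have "\<mu> > 1/5" unfolding \<mu>_def using v 5 by (simp add: field_simps)
      then show ?thesis using 5 v by simp
    qed
  qed
  moreover have "real v1 - 2 + \<mu> > 0" using mu v k by linarith
  ultimately show ?thesis by (simp add: field_simps)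
qed

text \<open>Turns the structural exclusions into the numerical side conditions of
  \<open>regular_pair_density_bound\<close>.\<close>

lemma m2_pair_less_half_degrees:
  fixes H1 :: "'a graph" and H2 :: "'b graph"
  assumes wf: "wf_graph H1" "wf_graph H2" and ne: "nonempty_graph H1" "nonempty_graph H2"
    and reg: "\<forall>v\<in>verts H1. degree H1 v = k1" "\<forall>v\<in>verts H2. degree H2 v = k2"
    and niso: "\<not> isomorphic H1 H2"
    and m: "m2 H1 \<ge> m2 H2" "m2 H2 > 1"
    and bal: "strictly_2_balanced H2"
      "m2 H1 > m2 H2 \<Longrightarrow> strictly_balanced_pair H1 H2"
      "m2 H1 = m2 H2 \<Longrightarrow> strictly_2_balanced H1"
    and exc: "\<not> ((complete_graph H1 \<and> is_cycle H2) \<or> (complete_graph H2 \<and> is_cycle H1))"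
      "\<not> (is_cycle H2 \<and> vnum H1 \<ge> vnum H2)"
      "\<not> (isomorphic H1 (K 3) \<and> isomorphic H2 K33)"
  shows "m2_pair H1 H2 < (real k1 + real k2 - 1) / 2"
proof -
  have k: "k1 \<ge> 2" "k2 \<ge> 2"
    using m2_gt_1_degree_ge_2[OF wf(1) _ reg(1)] m2_gt_1_degree_ge_2[OF wf(2) _ reg(2)] m by auto
  have dH2: "m2 H2 = d2 H2" using strictly_2_balanced_m2 wf bal by blast
  note D2 = d2_gt_1D[OF m(2)[unfolded dH2]]
  have e1: "2 * enum H1 = k1 * vnum H1" and e2: "2 * enum H2 = k2 * vnum H2"
    using regular_enum wf reg by blast+
  have re1: "real (enum H1) = real k1 * real (vnum H1) / 2"
    using arg_cong[OF e1, of real] by simp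
  have re2: "real (enum H2) = real k2 * real (vnum H2) / 2"
    using arg_cong[OF e2, of real] by simp
  have n1: "vnum H1 \<ge> 2" using nonempty_vnum wf ne by blast
  obtain a b where "a \<in> verts H1" "b \<in> verts H2"
    using n1 D2(2) by (metis all_not_in_conv card.empty vnum_def not_numeral_le_zero)
  then have v: "vnum H1 \<ge> k1 + 1" "vnum H2 \<ge> k2 + 1"
    using degree_less_vnum wf reg by fastforce+
  have ev: "even (k2 * vnum H2)" using e2 by (metis dvd_triv_left)
  have pair: "m2_pair H1 H2 = d2_pair H1 H2"
    using m2_pair_symmetric[OF wf(1) _ ne(2)] strictly_balanced_pair_m2_pair[OF wf(1)] bal m by fastforce
  \<comment> \<open>Here \<open>H2\<close> is a cycle. A complete \<open>H1\<close> is then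
    excluded, so \<open>vnum H1\<close> is not \<open>k1 + 1\<close>; the comparison of orders is
    the other exclusion for cycles.\<close>
  have c2: "vnum H1 \<ge> k1 + 2 \<and> vnum H1 < vnum H2" if "k2 = 2"
  proof -
    have "is_cycle H2"
      using two_regular_strictly_2_balanced_is_cycle wf bal m reg that by blast
    then show ?thesis using exc regular_complete[OF wf(1) reg(1)] v(1) by force
  qed
  \<comment> \<open>\<open>H1\<close> would be a triangle, hence a cycle, so \<open>H2\<close> is
    not complete and has six vertices. Strict 2-balance makes it triangle-free, hence
    \<open>K33\<close>, which is excluded.\<close>
  have c33: "\<not> (k1 = 2 \<and> vnum H1 = 3 \<and> k2 = 3 \<and> (vnum H2 = 4 \<or> vnum H2 = 6))"
  proof
    assume A: "k1 = 2 \<and> vnum H1 = 3 \<and> k2 = 3 \<and> (vnum H2 = 4 \<or> vnum H2 = 6)"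
    have K3: "isomorphic H1 (K 3)"
      using A regular_complete[OF wf(1) reg(1)] wf K_wf_complete by (intro complete_isomorphic) auto
    then have "is_cycle H1" by (auto simp: is_cycle_def K_3_eq_cycle_graph_3)
    then have "\<not> complete_graph H2" using exc by blast
    then have 6: "vnum H2 = 6" using A regular_complete[OF wf(2) reg(2)] by auto
    then have m2: "m2 H2 = 2" using dH2 D2(3) A re2 by simp
    have "isomorphic H2 K33"
    proof (rule cubic_triangle_free_K33[OF wf(2) _ 6])
      show "\<forall>v\<in>verts H2. degree H2 v = 3" using reg A by simp
      fix a b c assume e: "{a, b} \<in> edges H2" "{b, c} \<in> edges H2"
      show "{a, c} \<notin> edges H2"
      proof
        assume "{a, c} \<in> edges H2"
        note T = triangle_d2[OF wf(2) e this]
        have "vnum ({a, b, c}, {{a, b}, {b, c}, {a, c}}) \<le> 3"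
          by (simp add: vnum_def verts_def card_insert_if)
        then have "({a, b, c}, {{a, b}, {b, c}, {a, c}}) \<noteq> H2" using 6 by auto
        then show False using T bal(1) m2 unfolding strictly_2_balanced_def by fastforce
      qed
    qed
    then show False using exc K3 by blast
  qed
  \<comment> \<open>Both graphs would be complete on four vertices and so isomorphic.\<close>
  have c44: "\<not> (k1 = 3 \<and> vnum H1 = 4 \<and> k2 = 3 \<and> vnum H2 = 4)"
    using complete_isomorphic[OF wf] regular_complete[OF wf(1) reg(1)]
      regular_complete[OF wf(2) reg(2)] niso by auto
  have "1 / m2 H2 = (real (vnum H2) - 2) / (real k2 * real (vnum H2) / 2 - 1)"
    using dH2 D2(3) re2 by simp
  then show ?thesis
    using regular_pair_density_bound[OF k v D2(2) ev c2 c33 c44] pair ne n1 re1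
    by (simp add: d2_pair_def)
qed

section \<open>Minimum degree of the graphs in \<open>Ahat\<close>\<close>

text \<open>The density of \<open>A\<close> is half its average degree, and \<open>A\<close> counts
  among its own subgraphs.\<close>

lemma min_degree_m_dens:
  assumes "wf_graph A" "verts A \<noteq> {}" "\<And>v. v \<in> verts A \<Longrightarrow> degree A v \<ge> k"
  shows "m_dens A \<ge> real k / 2"
proof -
  have "vnum A * k \<le> (\<Sum>v\<in>verts A. degree A v)"
    unfolding vnum_def using assms by (intro sum_bounded_below[of "verts A" k, simplified])
  then have "vnum A * k \<le> 2 * enum A" using sum_degree[OF assms(1)] by simp
  then have "real (vnum A * k) \<le> real (2 * enum A)" by (simp only: of_nat_le_iff)
  moreover have "vnum A \<ge> 1" using assms by (simp add: vnum_def Suc_le_eq card_gt_0_iff wf_finite_verts)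
  ultimately have "real k / 2 \<le> dens A" by (simp add: dens_def field_simps)
  also have "\<dots> \<le> m_dens A"
    unfolding m_dens_def using finite_subgraphs[OF assms(1)] subgraph_refl[OF assms(1)]
    by (intro Max_ge) blast+
  finally show ?thesis .
qed

text \<open>With at least three vertices there is a path from \<open>v\<close> to another vertex;
  take its first edge.\<close>

lemma two_connected_incident_edge:
  assumes "wf_graph A" "two_connected A" "v \<in> verts A"
  obtains e where "e \<in> edges A" "v \<in> e"
proof -
  have "\<not> verts A \<subseteq> {v}"
    using assms card_mono[of "{v}" "verts A"] by (auto simp: two_connected_def vnum_def)
  then obtain u where u: "u \<in> verts A" "u \<noteq> v" by blast
  then have "(v, u) \<in> {(x, y). {x, y} \<in> edges A}\<^sup>*"
    using assms by (auto simp: two_connected_def connected_graph_def)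
  then obtain w where "{v, w} \<in> edges A"
    using u by (auto elim: converse_rtranclE)
  then show ?thesis using that by blast
qed

text \<open>At \<open>v\<close> the two copies contribute \<open>k1\<close> and \<open>k2\<close>
  edges of \<open>A\<close>, and only \<open>e\<close> is counted twice.\<close>

lemma copies_sharing_edge_degree:
  assumes wf: "wf_graph A" "wf_graph H1" "wf_graph H2"
    and reg: "\<forall>v\<in>verts H1. degree H1 v = k1" "\<forall>v\<in>verts H2. degree H2 v = k2"
    and LR: "L \<in> copies H2 A" "R \<in> copies H1 A" "edges L \<inter> edges R = {e}" and v: "v \<in> e"
  shows "k1 + k2 - 1 \<le> degree A v"
proof -
  have sub: "subgraph L A" "subgraph R A" and iso: "isomorphic L H2" "isomorphic R H1"
    using LR by (auto simp: copies_def)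
  then have wLR: "wf_graph L" "wf_graph R" by (auto simp: subgraph_def)
  have "v \<in> verts L" "v \<in> verts R"
    using v LR(3) wf_edges_Pow[OF wLR(1)] wf_edges_Pow[OF wLR(2)] by blast+
  then have d: "degree L v = k2" "degree R v = k1"
    using isomorphic_degree wLR wf iso reg by metis+
  let ?S = "\<lambda>G. {e \<in> edges G. v \<in> e}"
  have fin: "finite (?S L)" "finite (?S R)" "finite (?S A)"
    using wLR wf(1) by (simp_all add: wf_finite_edges)
  have "card (?S L \<inter> ?S R) \<le> card {e}" using LR(3) by (intro card_mono) auto
  moreover have "card (?S L \<union> ?S R) \<le> card (?S A)"
    using sub fin by (intro card_mono) (auto simp: subgraph_def)
  ultimately show ?thesis
    using card_Un_Int[OF fin(1,2)] d by (simp add: degree_def)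
qed

theorem theorem1p4:
  fixes H1 H2 :: "nat graph"
  assumes "wf_graph H1" and "wf_graph H2"
    and "nonempty_graph H1" and "nonempty_graph H2"
    and "regular H1" and "regular H2"
    and "\<not> isomorphic H1 H2"
    and "m2 H1 \<ge> m2 H2" and "m2 H2 > 1"
    and "strictly_2_balanced H2"
    and "m2 H1 > m2 H2 \<Longrightarrow> strictly_balanced_pair H1 H2"
    and "m2 H1 = m2 H2 \<Longrightarrow> strictly_2_balanced H1"
    and "\<not> ((complete_graph H1 \<and> is_cycle H2) \<or> (complete_graph H2 \<and> is_cycle H1))"
    and "\<not> (is_cycle H2 \<and> vnum H1 \<ge> vnum H2)"
    and "\<not> (isomorphic H1 (K 3) \<and> isomorphic H2 K33)"
  shows "\<exists>\<epsilon>>0. finite_up_to_iso (Ahat H1 H2 \<epsilon>) \<and>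
           (\<forall>A\<in>Ahat H1 H2 \<epsilon>. has_valid_colouring H1 H2 A)"
proof -
  obtain k1 k2 where reg: "\<forall>v\<in>verts H1. degree H1 v = k1" "\<forall>v\<in>verts H2. degree H2 v = k2"
    using assms by (auto simp: regular_def)
  have k: "k1 \<ge> 2"
    using m2_gt_1_degree_ge_2[OF assms(1) _ reg(1)] assms by auto
  define \<delta> where "\<delta> = (real k1 + real k2 - 1) / 2 - m2_pair H1 H2"
  have \<delta>: "\<delta> > 0"
    using m2_pair_less_half_degrees[OF assms(1-4) reg assms(7-15)] by (simp add: \<delta>_def)
  \<comment> \<open>\<open>\<delta>\<close> is the gap between the two bounds; half of it leaves
    room for a strict contradiction.\<close>
  have "Ahat H1 H2 (\<delta> / 2) = {}"
  proof (rule equals0I)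
    fix A assume "A \<in> Ahat H1 H2 (\<delta> / 2)"
    then have A: "wf_graph A" "two_connected A" "m_dens A \<le> m2_pair H1 H2 + \<delta> / 2"
      and cls: "classCstar H1 H2 A \<or> classC H1 H2 A"
      by (auto simp: Ahat_def split: if_splits)
    \<comment> \<open>A member of \<open>Lstar\<close> comes with a suitable copy of
      \<open>H1\<close> for each of its edges, in particular for \<open>e\<close>, so both classes
      yield the same property.\<close>
    have cls': "\<exists>L\<in>copies H2 A. \<exists>R\<in>copies H1 A. edges L \<inter> edges R = {e}" if "e \<in> edges A" for e
      using cls that unfolding classCstar_def classC_def Lstar_def by blast
    have "k1 + k2 - 1 \<le> degree A v" if v: "v \<in> verts A" for v
    proof -
      obtain e where "e \<in> edges A" "v \<in> e" using two_connected_incident_edge[OF A(1,2) v] by blast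
      then show ?thesis
        using cls' copies_sharing_edge_degree[OF A(1) assms(1,2) reg] by blast
    qed
    moreover have "verts A \<noteq> {}" using A(2) by (auto simp: two_connected_def vnum_def)
    ultimately have "real (k1 + k2 - 1) / 2 \<le> m_dens A" using min_degree_m_dens A(1) by blast
    \<comment> \<open>\<open>k1 \<ge> 2\<close> keeps the natural subtraction in
      \<open>k1 + k2 - 1\<close> from truncating.\<close>
    then show False using A(3) \<delta> k by (simp add: \<delta>_def of_nat_diff field_simps)
  qed
  then show ?thesis
    using \<delta> by (intro exI[of _ "\<delta> / 2"]) (auto simp: finite_up_to_iso_def)
qed

end
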